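(* Let $G$ be the non-abelian group of order $27$ and exponent $3$. Every sequence of length $7$ over $G$ contains a non-empty product-one subsequence. Consequently $\mathsf{d}(G)=6$.
   Context: A sequence over $G$ is a finite unordered list (multiset) of elements of $G$; a subsequence is a sub-multiset; a non-empty sequence is product-one if some ordering of its terms has product $1$. The small Davenport constant $\mathsf{d}(G)$ is the maximal length of a sequence over $G$ having no non-empty product-one subsequence. *)

theory Defs
  imports "HOL-Algebra.Group" "HOL-Library.Multiset"
begin

definition seq_over :: "('a, 'b) monoid_scheme \<Rightarrow> 'a multiset \<Rightarrow> bool" where
  "seq_over G S \<longleftrightarrow> set_mset S \<subseteq> carrier G"

definition product_one :: "('a, 'b) monoid_scheme \<Rightarrow> 'a multiset \<Rightarrow> bool" where
  "product_one G S \<longleftrightarrow> S \<noteq> {#} \<and>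
     (\<exists>xs. mset xs = S \<and> foldr (\<lambda>x y. x \<otimes>\<^bsub>G\<^esub> y) xs \<one>\<^bsub>G\<^esub> = \<one>\<^bsub>G\<^esub>)"

definition product_one_free :: "('a, 'b) monoid_scheme \<Rightarrow> 'a multiset \<Rightarrow> bool" where
  "product_one_free G S \<longleftrightarrow> \<not> (\<exists>T. T \<subseteq># S \<and> product_one G T)"

definition small_davenport :: "('a, 'b) monoid_scheme \<Rightarrow> nat" where
  "small_davenport G = (GREATEST n. \<exists>S. seq_over G S \<and> product_one_free G S \<and> size S = n)"

end

theory Submission
  imports Defs
begin

text \<open>
  Two non-commuting elements x, y of G satisfy y x = x y z with z central of order 3, so G is the
  Heisenberg group over the field F of three elements, and a subsequence multiplies to a central
  element iff its image in F^2 has sum zero. Swapping two adjacent non-commuting factors of an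
  ordered product shifts its central coordinate by a nonzero amount. Hence a zero-sum subsequence
  attains all three central values if it contains two disjoint non-commuting pairs, and at least
  two if it contains one such pair; in the latter case a further disjoint zero-sum subsequence
  supplies the missing value. Moreover five elements on one line through the origin of F^2 lie in
  an elementary abelian subgroup of order 9, whose Davenport constant is 5. Choosing coordinates
  such that x and y are terms of the sequence, one of these three situations arises among any seven
  vectors that include (1,0) and (0,1): this is a finite search in F^2.
\<close>

section \<open>Heisenberg coordinates\<close>

type_synonym F3 = Enum.finite_3
type_synonym vec = "F3 \<times> F3"
type_synonym triple = "F3 \<times> F3 \<times> F3"

text \<open>The law of the normal forms x^i y^j z^k: moving y^j to the right past x^i' produces z^(j
  i').\<close>

fun heis_mult :: "triple \<Rightarrow> triple \<Rightarrow> triple" where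
  "heis_mult (i, j, k) (i', j', k') = (i + i', j + j', k + k' + j * i')"

lemmas F3_arith = plus_finite_3_def times_finite_3_def minus_finite_3_def uminus_finite_3_def
  zero_finite_3_def one_finite_3_def

text \<open>By default the simplifier replaces 0 and 1 by constructors, which blocks the ring laws.\<close>

declare zero_finite_3_def [simp del] one_finite_3_def [simp del]

text \<open>Least residues, so that field elements can serve as exponents in a group of exponent
  3.\<close>

definition F3_nat :: "F3 \<Rightarrow> nat" where
  "F3_nat a = (if a = 0 then 0 else if a = 1 then 1 else 2)"

lemma F3_cases: "(a :: F3) = 0 \<or> a = 1 \<or> a = -1"
  by (cases a) (simp_all add: F3_arith)

lemma F3_nat_add: "F3_nat (a + b) = (F3_nat a + F3_nat b) mod 3"
  by (cases a; cases b) (simp_all add: F3_nat_def F3_arith)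

lemma F3_nat_mult: "F3_nat (a * b) = (F3_nat a * F3_nat b) mod 3"
  by (cases a; cases b) (simp_all add: F3_nat_def F3_arith)

lemma F3_nat_0 [simp]: "F3_nat 0 = 0" and F3_nat_1 [simp]: "F3_nat 1 = 1"
  by (simp_all add: F3_nat_def)

text \<open>Expanding (c d)^3 = 1 turns c d c into d^-1 c^-1 d^-1. Two uses of this move a past its
  conjugate. It will make the commutator of x and y commute with both.\<close>

lemma (in group) exponent_3_conj_commute:
  assumes exp3: "\<forall>g\<in>carrier G. g [^] (3::nat) = \<one>" and a: "a \<in> carrier G" and b: "b \<in> carrier G"
  shows "a \<otimes> (inv b \<otimes> a \<otimes> b) = (inv b \<otimes> a \<otimes> b) \<otimes> a"
proof -
  have cube: "g \<otimes> (g \<otimes> g) = \<one>" if "g \<in> carrier G" for g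
    using exp3 that by (simp add: numeral_3_eq_3 m_assoc)
  have flip: "c \<otimes> d \<otimes> c = inv d \<otimes> inv c \<otimes> inv d" if c: "c \<in> carrier G" and d: "d \<in> carrier G" for c d
  proof -
    have "(c \<otimes> d \<otimes> c) \<otimes> (d \<otimes> c \<otimes> d) = \<one>"
      using cube[of "c \<otimes> d"] c d by (simp add: m_assoc)
    then have "c \<otimes> d \<otimes> c = inv (d \<otimes> c \<otimes> d)"
      using c d by (metis inv_equality m_closed)
    then show ?thesis
      using c d by (simp add: inv_mult_group m_assoc)
  qed
  have sq: "g \<otimes> g = inv g" if "g \<in> carrier G" for g
    using cube[OF that] that by (metis inv_equality m_closed m_assoc)
  have "a \<otimes> (inv b \<otimes> a \<otimes> b) = (a \<otimes> inv b \<otimes> a) \<otimes> b"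
    using a b by (simp add: m_assoc)
  also have "\<dots> = b \<otimes> inv a \<otimes> (b \<otimes> b)"
    using a b flip[of a "inv b"] by (simp add: m_assoc)
  \<comment> \<open>Squaring is inversion, so \<open>b\<close> is the square of
    \<open>inv b\<close>. This creates the factor that \<open>flip\<close> converts back to
    \<open>a \<otimes> b \<otimes> a\<close>.\<close>
  also have "\<dots> = (inv b \<otimes> inv b) \<otimes> inv a \<otimes> inv b"
    using a b by (simp add: sq)
  also have "\<dots> = inv b \<otimes> (a \<otimes> b \<otimes> a)"
    using a b flip[of a b] by (simp add: m_assoc)
  also have "\<dots> = (inv b \<otimes> a \<otimes> b) \<otimes> a"
    using a b by (simp add: m_assoc)
  finally show ?thesis .
qed

text \<open>Each of the j factors y passes each of the i factors x, leaving one z per passage, and z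
  moves freely.\<close>

lemma (in group) commute_pow_pow:
  assumes x: "x \<in> carrier G" and y: "y \<in> carrier G" and z: "z \<in> carrier G"
    and yx: "y \<otimes> x = x \<otimes> y \<otimes> z" and zx: "z \<otimes> x = x \<otimes> z" and zy: "z \<otimes> y = y \<otimes> z"
  shows "y [^] (j::nat) \<otimes> x [^] (i::nat) = x [^] i \<otimes> y [^] j \<otimes> z [^] (j * i)"
proof -
  have zxn: "z [^] n \<otimes> x = x \<otimes> z [^] n" and zyn: "z [^] n \<otimes> y = y \<otimes> z [^] n" for n :: nat
    using x y z zx zy group_commutes_pow by auto
  have base: "y \<otimes> x [^] i = x [^] i \<otimes> y \<otimes> z [^] i" for i :: nat
  proof (induction i)
    case 0
    then show ?case using y by simp
  next
    case (Suc i)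
    have "y \<otimes> x [^] Suc i = (y \<otimes> x [^] i) \<otimes> x"
      using x y by (simp add: m_assoc)
    also have "\<dots> = x [^] i \<otimes> y \<otimes> (z [^] i \<otimes> x)"
      using x y z by (simp add: Suc m_assoc)
    also have "\<dots> = x [^] i \<otimes> (y \<otimes> x) \<otimes> z [^] i"
      using x y z by (simp add: zxn m_assoc)
    also have "\<dots> = x [^] Suc i \<otimes> y \<otimes> (z \<otimes> z [^] i)"
      using x y z by (simp add: yx m_assoc)
    also have "z \<otimes> z [^] i = z [^] Suc i"
      using z nat_pow_Suc2 by simp
    finally show ?case .
  qed
  show ?thesis
  proof (induction j)
    case 0
    then show ?case using x by simp
  next
    case (Suc j)
    have "y [^] Suc j \<otimes> x [^] i = y [^] j \<otimes> (y \<otimes> x [^] i)"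
      using x y by (simp add: m_assoc)
    also have "\<dots> = (y [^] j \<otimes> x [^] i) \<otimes> (y \<otimes> z [^] i)"
      using x y z by (simp add: base m_assoc)
    also have "\<dots> = x [^] i \<otimes> y [^] j \<otimes> (z [^] (j * i) \<otimes> y) \<otimes> z [^] i"
      using x y z by (simp add: Suc m_assoc)
    also have "\<dots> = x [^] i \<otimes> y [^] Suc j \<otimes> (z [^] (j * i) \<otimes> z [^] i)"
      using x y z by (simp add: zyn m_assoc)
    also have "z [^] (j * i) \<otimes> z [^] i = z [^] (Suc j * i)"
      using z by (simp add: nat_pow_mult add.commute)
    finally show ?case .
  qed
qed

text \<open>The map sends (i, j, k) to x^i y^j z^k with z the commutator. Commuting such a product
  with y and with x reveals i and j as exponents of z, so the form is unique; the 27 triples then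
  fill the group by counting.\<close>

lemma (in group) heisenberg_coordinates:
  assumes card: "card (carrier G) = 27"
    and exp3: "\<forall>g\<in>carrier G. g [^] (3::nat) = \<one>"
    and x: "x \<in> carrier G" and y: "y \<in> carrier G" and nc: "x \<otimes> y \<noteq> y \<otimes> x"
  obtains w :: "triple \<Rightarrow> _"
  where "bij_betw w UNIV (carrier G)" "\<And>s t. w (heis_mult s t) = w s \<otimes> w t"
    and "w (1, 0, 0) = x" "w (0, 1, 0) = y"
proof -
  define z where "z = inv (x \<otimes> y) \<otimes> (y \<otimes> x)"
  have z: "z \<in> carrier G" using x y by (simp add: z_def)
  have yx: "y \<otimes> x = x \<otimes> y \<otimes> z"
    using x y by (simp add: z_def m_assoc[symmetric])
  have z1: "z \<noteq> \<one>"
    using yx nc x y by auto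
  \<comment> \<open>z is a conjugate of \<open>inv x\<close> times x, and both factors commute with
    x.\<close>
  have zx: "z \<otimes> x = x \<otimes> z"
  proof -
    have "inv (inv y \<otimes> x \<otimes> y) = inv y \<otimes> inv x \<otimes> y"
      using x y by (simp add: inv_mult_group m_assoc)
    moreover have "inv (inv y \<otimes> x \<otimes> y) \<otimes> x = x \<otimes> inv (inv y \<otimes> x \<otimes> y)"
      using exponent_3_conj_commute[OF exp3 x y] x y
      by (metis inv_closed inv_solve_left inv_solve_right m_assoc m_closed)
    ultimately have "(inv y \<otimes> inv x \<otimes> y) \<otimes> x = x \<otimes> (inv y \<otimes> inv x \<otimes> y)"
      by simp
    moreover have "z = (inv y \<otimes> inv x \<otimes> y) \<otimes> x"
      using x y by (simp add: z_def inv_mult_group m_assoc)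
    ultimately show ?thesis
      using x y by (simp add: m_assoc)
  qed
  \<comment> \<open>Symmetrically, z is \<open>inv y\<close> times a conjugate of y.\<close>
  have zy: "z \<otimes> y = y \<otimes> z"
  proof -
    have "z = inv y \<otimes> (inv x \<otimes> y \<otimes> x)"
      using x y by (simp add: z_def inv_mult_group m_assoc)
    then have "z = inv y \<otimes> (inv x \<otimes> y \<otimes> x)" and "y \<otimes> z = inv x \<otimes> y \<otimes> x"
      using x y by (simp_all add: m_assoc[symmetric])
    moreover have "inv y \<otimes> ((inv x \<otimes> y \<otimes> x) \<otimes> y) = inv y \<otimes> (y \<otimes> (inv x \<otimes> y \<otimes> x))"
      using exponent_3_conj_commute[OF exp3 y x] by simp
    ultimately show ?thesis
      using x y by (simp add: m_assoc[symmetric])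
  qed
  define pw where "pw g a = g [^] F3_nat a" for g a
  have pw_closed [simp]: "pw g a \<in> carrier G" if "g \<in> carrier G" for g a
    using that by (simp add: pw_def)
  have pow_mod: "g [^] (n mod 3) = g [^] n" if "g \<in> carrier G" for g and n :: nat
  proof -
    have "g [^] n = g [^] (3 * (n div 3) + n mod 3)" by simp
    also have "\<dots> = (g [^] (3::nat)) [^] (n div 3) \<otimes> g [^] (n mod 3)"
      using that by (simp only: nat_pow_mult[symmetric] nat_pow_pow)
    finally show ?thesis using exp3 that by simp
  qed
  have pw_add: "pw g (a + b) = pw g a \<otimes> pw g b" if "g \<in> carrier G" for g a b
    using that by (simp add: pw_def F3_nat_add pow_mod nat_pow_mult)
  have pw_0 [simp]: "pw g 0 = \<one>" and pw_1 [simp]: "g \<in> carrier G \<Longrightarrow> pw g 1 = g" for g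
    by (simp_all add: pw_def)
  have yxp: "pw y j \<otimes> pw x i = pw x i \<otimes> pw y j \<otimes> pw z (j * i)" for i j
    using commute_pow_pow[OF x y z yx zx zy] z by (simp add: pw_def F3_nat_mult pow_mod)
  have zxp: "pw z k \<otimes> pw x i = pw x i \<otimes> pw z k" and zyp: "pw z k \<otimes> pw y i = pw y i \<otimes> pw z k" for i k
    using zx zy x y z unfolding pw_def by (auto intro!: group_commutes_pow[symmetric] group_commutes_pow)
  have pw_inj: "a = b" if "pw z a = pw z b" for a b
  proof -
    have "pw z a \<otimes> pw z (- b) = pw z b \<otimes> pw z (- b)" using that by simp
    then have c: "pw z (a - b) = \<one>" using pw_add[OF z, symmetric] by simp
    \<comment> \<open>The values 1 and -1 of \<open>a - b\<close> are excluded because neither z nor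
      its inverse is trivial.\<close>
    have "pw z (-1) \<otimes> pw z 1 = \<one>" using pw_add[OF z, symmetric] by simp
    then have "pw z (-1) \<noteq> \<one>" using z z1 by auto
    then have "a - b = 0" using c F3_cases[of "a - b"] z z1 by auto
    then show ?thesis by simp
  qed
  define w where "w = (\<lambda>(i, j, k). pw x i \<otimes> pw y j \<otimes> pw z k)"
  have w_mult: "w (heis_mult s t) = w s \<otimes> w t" for s t
  proof -
    obtain i j k i' j' k' where st: "s = (i, j, k)" "t = (i', j', k')"
      by (metis prod.exhaust)
    \<comment> \<open>Rules for right-nested products with tail h: powers of x move left, powers of
      z move right, and y passing x leaves a power of z.\<close>
    have push: "pw z c \<otimes> (pw x a \<otimes> h) = pw x a \<otimes> (pw z c \<otimes> h)"
      "pw z c \<otimes> (pw y b \<otimes> h) = pw y b \<otimes> (pw z c \<otimes> h)"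
      "pw y b \<otimes> (pw x a \<otimes> h) = pw x a \<otimes> (pw y b \<otimes> (pw z (b * a) \<otimes> h))"
      if "h \<in> carrier G" for a b c h
      using x y z that by (simp_all add: m_assoc[symmetric] zxp zyp yxp)
    have "w s \<otimes> w t = pw x i \<otimes> (pw x i' \<otimes> (pw y j \<otimes> (pw y j' \<otimes> (pw z (j * i') \<otimes> (pw z k \<otimes> pw z k')))))"
      using x y z by (simp add: w_def st m_assoc push)
    also have "\<dots> = (pw x i \<otimes> pw x i') \<otimes> (pw y j \<otimes> pw y j') \<otimes> (pw z (j * i') \<otimes> (pw z k \<otimes> pw z k'))"
      using x y z by (simp add: m_assoc)
    also have "\<dots> = w (heis_mult s t)"
      using x y z by (simp add: w_def st pw_add[symmetric] add_ac)
    finally show ?thesis ..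
  qed
  have wx: "w (1, 0, 0) = x" and wy: "w (0, 1, 0) = y" and wz: "w (0, 0, k) = pw z k" for k
    using x y z by (simp_all add: w_def)
  have w_closed: "w t \<in> carrier G" for t
    using x y z by (auto simp: w_def split: prod.split)
  have inj: "inj w"
  proof (rule injI)
    fix s t assume eq: "w s = w t"
    obtain i j k i' j' k' where st: "s = (i, j, k)" "t = (i', j', k')"
      by (metis prod.exhaust)
    \<comment> \<open>Passing y or x across the product leaves a power of z that isolates the first
      or the second coordinate.\<close>
    have comm_y: "y \<otimes> w (a, b, c) = w (a, b, c) \<otimes> y \<otimes> pw z a" 
      and comm_x: "w (a, b, c) \<otimes> x = x \<otimes> w (a, b, c) \<otimes> pw z b" for a b c
      unfolding wx[symmetric] wy[symmetric] wz[symmetric] w_mult[symmetric] by (simp_all add: add_ac)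
    have "w s \<otimes> y \<otimes> pw z i = w s \<otimes> y \<otimes> pw z i'"
      using comm_y eq st by metis
    then have i: "i = i'" using pw_inj w_closed y z by simp
    have "x \<otimes> w s \<otimes> pw z j = x \<otimes> w s \<otimes> pw z j'"
      using comm_x eq st by metis
    then have j: "j = j'" using pw_inj w_closed x z by simp
    have "k = k'" using eq i j pw_inj x y z by (simp add: st w_def)
    then show "s = t" using i j st by simp
  qed
  have "card (UNIV :: triple set) = 27"
    by (simp add: card_cartesian_product UNIV_finite_3 flip: UNIV_Times_UNIV)
  then have "card (range w) = card (carrier G)"
    using inj card by (simp add: card_image)
  moreover have "range w \<subseteq> carrier G" using w_closed by auto
  moreover have "finite (carrier G)" using card card.infinite by fastforce
  ultimately have "range w = carrier G" by (metis card_subset_eq)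
  then show thesis
    using that[of w] inj w_mult wx wy by (simp add: bij_betw_def)
qed

section \<open>Products in coordinates\<close>

definition heis_prod :: "triple list \<Rightarrow> triple" where
  "heis_prod ts = foldr heis_mult ts (0, 0, 0)"

lemma heis_prod_simps [simp]:
  "heis_prod [] = (0, 0, 0)" "heis_prod (t # ts) = heis_mult t (heis_prod ts)"
  by (simp_all add: heis_prod_def)

lemma heis_prod_append: "heis_prod (ss @ ts) = heis_mult (heis_prod ss) (heis_prod ts)"
proof (induction ss)
  case Nil
  then show ?case by (cases "heis_prod ts") simp
next
  case (Cons s ss)
  then show ?case
    by (cases s; cases "heis_prod ss"; cases "heis_prod ts") (simp add: algebra_simps)
qed

fun proj :: "triple \<Rightarrow> vec" where
  "proj (i, j, k) = (i, j)"

text \<open>The commutator form, a determinant up to sign: the difference of the central coordinates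
  when two triples are multiplied in both orders. It vanishes iff the vectors are linearly
  dependent.\<close>

fun cross :: "vec \<Rightarrow> vec \<Rightarrow> F3" where
  "cross (i, j) (i', j') = j * i' - j' * i"

definition zero_sum :: "vec list \<Rightarrow> bool" where
  "zero_sum vs \<longleftrightarrow> sum_list (map fst vs) = 0 \<and> sum_list (map snd vs) = 0"

lemma zero_sum_cong_mset: "mset us = mset vs \<Longrightarrow> zero_sum us \<longleftrightarrow> zero_sum vs"
  unfolding zero_sum_def by (metis mset_map sum_mset_sum_list)

lemma proj_heis_prod: "proj (heis_prod ts) = (sum_list (map fst (map proj ts)), sum_list (map snd (map proj ts)))"
proof (induction ts)
  case (Cons t ts)
  then show ?case by (cases t; cases "heis_prod ts") simp
qed simp

lemma zero_sum_heis_prod: "zero_sum (map proj ts) \<longleftrightarrow> (\<exists>k. heis_prod ts = (0, 0, k))"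
  using proj_heis_prod[of ts] by (cases "heis_prod ts") (auto simp: zero_sum_def)

section \<open>Steering the central coordinate by reordering\<close>

definition contains_one :: "triple multiset \<Rightarrow> bool" where
  "contains_one M \<longleftrightarrow> (\<exists>ts. ts \<noteq> [] \<and> mset ts \<subseteq># M \<and> heis_prod ts = (0, 0, 0))"

text \<open>The values 0, d, e, d + e exhaust the field, whether e = d or e = -d.\<close>

lemma F3_two_shifts:
  fixes d e k :: F3
  assumes "d \<noteq> 0" "e \<noteq> 0"
  shows "k = 0 \<or> k - d = 0 \<or> k - e = 0 \<or> k - d - e = 0"
  using assms by (cases d; cases e; cases k) (simp_all add: F3_arith)

text \<open>For nonzero l this is the case of two shifts with e = -l.\<close>

lemma F3_shift_and_translate:
  fixes d k l :: F3
  assumes "d \<noteq> 0"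
  shows "k = 0 \<or> k - d = 0 \<or> l = 0 \<or> k + l = 0 \<or> k - d + l = 0"
  using assms by (cases d; cases k; cases l) (simp_all add: F3_arith)

text \<open>The correction in the central coordinate sums a bilinear term over all ordered pairs of
  factors; the swap alters only the term of a and b.\<close>

lemma heis_prod_swap:
  assumes "heis_prod (ts @ a # b # us) = (i, j, k)"
  shows "heis_prod (ts @ b # a # us) = (i, j, k - cross (proj a) (proj b))"
  using assms
  by (cases a; cases b; cases "heis_prod ts"; cases "heis_prod us")
     (auto simp: heis_prod_append algebra_simps)

text \<open>The two swaps act independently, so four orderings of the same terms have central values
  k, k - e, k - f and k - e - f.\<close>

lemma contains_one_two_pairs:
  assumes sub: "mset (a # b # c # d # r) \<subseteq># M" and zs: "zero_sum (map proj (a # b # c # d # r))"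
    and ab: "cross (proj a) (proj b) \<noteq> 0" and cd: "cross (proj c) (proj d) \<noteq> 0"
  shows "contains_one M"
proof -
  define e f where "e = cross (proj a) (proj b)" and "f = cross (proj c) (proj d)"
  obtain k where 1: "heis_prod (a # b # c # d # r) = (0, 0, k)"
    using zs zero_sum_heis_prod by blast
  have 2: "heis_prod (b # a # c # d # r) = (0, 0, k - e)"
    using heis_prod_swap[of "[]"] 1 unfolding e_def by (metis append_Nil)
  have 3: "heis_prod (a # b # d # c # r) = (0, 0, k - f)"
    using heis_prod_swap[of "[a, b]" c d r] 1 unfolding f_def by simp
  have 4: "heis_prod (b # a # d # c # r) = (0, 0, k - e - f)"
    using heis_prod_swap[of "[b, a]" c d r] 2 unfolding f_def by simp
  have "k = 0 \<or> k - e = 0 \<or> k - f = 0 \<or> k - e - f = 0"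
    using F3_two_shifts ab cd e_def f_def by blast
  then obtain ts where "ts \<noteq> []" "mset ts = mset (a # b # c # d # r)" "heis_prod ts = (0, 0, 0)"
    using 1 2 3 4 that[of "a # b # c # d # r"] that[of "b # a # c # d # r"] that[of "a # b # d # c # r"]
      that[of "b # a # d # c # r"] by (auto simp del: heis_prod_simps)
  then show ?thesis using sub unfolding contains_one_def by metis
qed

lemma contains_one_pair_and_disjoint:
  assumes sub: "mset (a # b # r @ s) \<subseteq># M" and zs: "zero_sum (map proj (a # b # r))"
    and ab: "cross (proj a) (proj b) \<noteq> 0" and s: "s \<noteq> []" "zero_sum (map proj s)"
  shows "contains_one M"
proof -
  define e where "e = cross (proj a) (proj b)"
  obtain k where 1: "heis_prod (a # b # r) = (0, 0, k)"
    using zs zero_sum_heis_prod by blast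
  have 2: "heis_prod (b # a # r) = (0, 0, k - e)"
    using heis_prod_swap[of "[]"] 1 unfolding e_def by (metis append_Nil)
  obtain l where 3: "heis_prod s = (0, 0, l)"
    using s zero_sum_heis_prod by blast
  have 4: "heis_prod ((a # b # r) @ s) = (0, 0, k + l)" "heis_prod ((b # a # r) @ s) = (0, 0, k - e + l)"
    unfolding heis_prod_append 1 2 3 by simp_all
  have one: "contains_one M" if "ts \<noteq> []" "mset ts \<subseteq># mset (a # b # r @ s)" "heis_prod ts = (0, 0, 0)" for ts
    using that sub subset_mset.order_trans unfolding contains_one_def by blast
  have "k = 0 \<or> k - e = 0 \<or> l = 0 \<or> k + l = 0 \<or> k - e + l = 0"
    using F3_shift_and_translate ab e_def by blast
  then show ?thesis
  proof (elim disjE)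
    assume "k = 0" then show ?thesis using 1 by (intro one[of "a # b # r"]) simp_all
  next
    assume "k - e = 0" then show ?thesis using 2 by (intro one[of "b # a # r"]) simp_all
  next
    assume "l = 0" then show ?thesis using 3 s(1) by (intro one[of s]) simp_all
  next
    assume "k + l = 0" then show ?thesis using 4(1) by (intro one[of "(a # b # r) @ s"]) simp_all
  next
    assume "k - e + l = 0" then show ?thesis using 4(2) by (intro one[of "(b # a # r) @ s"]) simp_all
  qed
qed

text \<open>Lifts a subsequence found among images to the original terms, respecting
  multiplicities.\<close>

lemma mset_subset_map_lift:
  assumes "mset vs \<subseteq># image_mset f M"
  obtains us where "map f us = vs" "mset us \<subseteq># M"
  using assms
proof (induction vs arbitrary: M thesis)
  case (Cons v vs)
  then have "v \<in># image_mset f M" by (auto dest: mset_subset_eqD)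
  then obtain u N where u: "v = f u" "M = add_mset u N"
    by (metis (no_types, lifting) imageE multi_member_split set_image_mset)
  then have "mset vs \<subseteq># image_mset f N" using Cons.prems by simp
  then obtain us where "map f us = vs" "mset us \<subseteq># N" using Cons.IH by blast
  then show ?case using u Cons.prems(1)[of "u # us"] by simp
qed simp

section \<open>Exhaustive search in the plane\<close>

text \<open>
  The conditionals below replace the propositional connectives because rewriting evaluates both
  arguments of a connective, but only the selected branch of a conditional.
\<close>

fun splits :: "'a list \<Rightarrow> ('a list \<times> 'a list) list" where
  "splits [] = [([], [])]"
| "splits (x # xs) = map (\<lambda>(a, b). (x # a, b)) (splits xs) @ map (\<lambda>(a, b). (a, x # b)) (splits xs)"

fun picks :: "'a list \<Rightarrow> ('a \<times> 'a list) list" where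
  "picks [] = []"
| "picks (x # xs) = (x, xs) # map (\<lambda>(y, r). (y, x # r)) (picks xs)"

fun some_in :: "('a \<Rightarrow> bool) \<Rightarrow> 'a list \<Rightarrow> bool" where
  "some_in P [] = False"
| "some_in P (x # xs) = (if P x then True else some_in P xs)"

text \<open>
  Every multiset of n elements of cs, added to vs, passes through a list satisfying P when its
  elements are inserted in the order of cs.
\<close>

fun search :: "('a list \<Rightarrow> bool) \<Rightarrow> nat \<Rightarrow> 'a list \<Rightarrow> 'a list \<Rightarrow> bool" where
  "search P 0 vs cs = False"
| "search P (Suc n) vs [] = True"
| "search P (Suc n) vs (c # cs) =
    (if if P (c # vs) then True else search P n (c # vs) (c # cs)
     then search P (Suc n) vs cs else False)"

lemma splits_mset: "(t, r) \<in> set (splits vs) \<Longrightarrow> mset t + mset r = mset vs"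
  by (induction vs arbitrary: t r) auto

lemma picks_mset: "(a, r) \<in> set (picks vs) \<Longrightarrow> add_mset a (mset r) = mset vs"
  by (induction vs arbitrary: a r) (auto simp: add_mset_commute)

lemma some_in_iff: "some_in P xs \<longleftrightarrow> (\<exists>x\<in>set xs. P x)"
  by (induction xs) auto

text \<open>If c occurs in M, one copy moves to vs while c stays available for repetitions;
  otherwise c is dropped. Monotonicity of Q permits stopping as soon as P holds. An exhausted
  candidate list contradicts M being non-empty.\<close>

lemma search_sound:
  assumes "search P n vs cs" "n \<le> size M" "set_mset M \<subseteq> set cs"
    and P: "\<And>vs. P vs \<Longrightarrow> Q (mset vs)" and mono: "\<And>A B. Q A \<Longrightarrow> A \<subseteq># B \<Longrightarrow> Q B"
  shows "Q (mset vs + M)"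
  using assms
proof (induction P n vs cs arbitrary: M rule: search.induct)
  case (3 P n vs c cs)
  note P = "3.prems"(4) and mono = "3.prems"(5)
  show ?case
  proof (cases "c \<in># M")
    case True
    then obtain N where N: "M = add_mset c N" by (metis multi_member_split)
    show ?thesis
    proof (cases "P (c # vs)")
      case True
      then have "Q (mset (c # vs))" by (rule P)
      then show ?thesis by (rule mono) (simp add: N)
    next
      case False
      then have "Q (mset (c # vs) + N)"
        using "3.prems" N by (intro "3.IH"(1)) (auto split: if_splits)
      then show ?thesis by (simp add: N)
    qed
  next
    case False
    then show ?thesis
      using "3.prems" by (intro "3.IH"(2)) (auto split: if_splits)
  qed
qed auto

section \<open>Zero sums and unavoidable configurations in the plane\<close>

definition all_vecs :: "vec list" where
  "all_vecs = [(0, 0), (1, 0), (0, 1), (1, 1), (-1, -1), (1, -1), (-1, 1), (-1, 0), (0, -1)]"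

lemma set_all_vecs: "set all_vecs = UNIV"
proof -
  have "(i, j) \<in> set all_vecs" for i j
    using F3_cases[of i] F3_cases[of j] by (auto simp: all_vecs_def)
  then show ?thesis by auto
qed

definition has_zero_sum :: "vec list \<Rightarrow> bool" where
  "has_zero_sum vs = some_in (\<lambda>(t, r). if t = [] then False else zero_sum t) (splits vs)"

lemma has_zero_sumD: "has_zero_sum vs \<Longrightarrow> \<exists>t. t \<noteq> [] \<and> mset t \<subseteq># mset vs \<and> zero_sum t"
proof -
  assume "has_zero_sum vs"
  then obtain t r where t: "(t, r) \<in> set (splits vs)" "t \<noteq> []" "zero_sum t"
    unfolding has_zero_sum_def some_in_iff by (auto split: if_splits)
  then have "mset t \<subseteq># mset vs" using splits_mset by (metis mset_subset_eq_add_left)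
  then show ?thesis using t by blast
qed

lemma davenport_F3_squared:
  fixes M :: "vec multiset"
  assumes "5 \<le> size M"
  obtains t where "t \<noteq> []" "mset t \<subseteq># M" "zero_sum t"
proof -
  \<comment> \<open>Five is written with \<open>Suc\<close> to match the patterns of
    \<open>search\<close> during evaluation.\<close>
  have "search has_zero_sum (Suc (Suc (Suc (Suc (Suc 0))))) [] all_vecs"
    by code_simp
  then have "\<exists>t. t \<noteq> [] \<and> mset t \<subseteq># mset [] + M \<and> zero_sum t"
  proof (rule search_sound)
    fix A B :: "vec multiset"
    assume "\<exists>t. t \<noteq> [] \<and> mset t \<subseteq># A \<and> zero_sum t" "A \<subseteq># B"
    then show "\<exists>t. t \<noteq> [] \<and> mset t \<subseteq># B \<and> zero_sum t"
      by (meson subset_mset.order_trans)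
  qed (use assms set_all_vecs has_zero_sumD in simp_all)
  then show thesis using that by auto
qed

text \<open>P receives the terms left over by the pair, so nesting asks for a second pair disjoint
  from the first.\<close>

definition crossing :: "vec list \<Rightarrow> (vec list \<Rightarrow> bool) \<Rightarrow> bool" where
  "crossing vs P = some_in (\<lambda>(a, r).
     some_in (\<lambda>(b, s). if cross a b = 0 then False else P s) (picks r)) (picks vs)"

lemma crossingD:
  assumes "crossing vs P"
  obtains a b s where "mset vs = mset (a # b # s)" "cross a b \<noteq> 0" "P s"
proof -
  obtain a r b s where "(a, r) \<in> set (picks vs)" "(b, s) \<in> set (picks r)" "cross a b \<noteq> 0" "P s"
    using assms unfolding crossing_def some_in_iff by (auto split: if_splits)
  then show thesis using that picks_mset by (metis mset.simps(2))
qed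

text \<open>The vectors counted lie on the line spanned by l, so their lifts all commute with a lift
  of l.\<close>

definition crowded_line :: "vec multiset \<Rightarrow> bool" where
  "crowded_line M \<longleftrightarrow> (\<exists>l. l \<noteq> (0, 0) \<and> 5 \<le> size {#v \<in># M. cross l v = 0#})"

definition two_crossing_pairs :: "vec multiset \<Rightarrow> bool" where
  "two_crossing_pairs M \<longleftrightarrow> (\<exists>a b c d r. mset (a # b # c # d # r) \<subseteq># M \<and>
     zero_sum (a # b # c # d # r) \<and> cross a b \<noteq> 0 \<and> cross c d \<noteq> 0)"

definition crossing_pair_and_disjoint :: "vec multiset \<Rightarrow> bool" where
  "crossing_pair_and_disjoint M \<longleftrightarrow> (\<exists>a b r s. mset (a # b # r @ s) \<subseteq># M \<and>
     zero_sum (a # b # r) \<and> cross a b \<noteq> 0 \<and> s \<noteq> [] \<and> zero_sum s)"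

text \<open>One split serves two configurations: after a crossing pair is removed from the zero-sum
  part t, either t has a second such pair or the complement r has a zero-sum part. The four vectors
  at the end represent the four lines through the origin.\<close>

definition unavoidable :: "vec list \<Rightarrow> bool" where
  "unavoidable vs =
    (if some_in (\<lambda>(t, r).
         if zero_sum t
         then crossing t (\<lambda>s. if crossing s (\<lambda>_. True) then True else has_zero_sum r)
         else False) (splits vs)
     then True
     else some_in (\<lambda>l. Suc (Suc (Suc (Suc (Suc 0)))) \<le> length (filter (\<lambda>v. cross l v = 0) vs))
       [(1, 0), (0, 1), (1, 1), (1, -1)])"

lemma unavoidableD:
  assumes "unavoidable vs"
  shows "two_crossing_pairs (mset vs) \<or> crossing_pair_and_disjoint (mset vs) \<or> crowded_line (mset vs)"
proof -
  consider (split) t r where "(t, r) \<in> set (splits vs)" "zero_sum t"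
      "crossing t (\<lambda>s. if crossing s (\<lambda>_. True) then True else has_zero_sum r)"
    | (line) l where "l \<in> {(1, 0), (0, 1), (1, 1), (1, -1)}" "5 \<le> length (filter (\<lambda>v. cross l v = 0) vs)"
    using assms unfolding unavoidable_def some_in_iff
    by (fastforce split: if_splits simp: numeral_eq_Suc)
  then show ?thesis
  proof cases
    case split
    have vs: "mset vs = mset t + mset r" using splits_mset[OF split(1)] by simp
    from split(3) obtain a b s where s: "mset t = mset (a # b # s)" "cross a b \<noteq> 0"
      and "if crossing s (\<lambda>_. True) then True else has_zero_sum r"
      by (rule crossingD)
    then consider "crossing s (\<lambda>_. True)" | "has_zero_sum r" by (auto split: if_splits)
    then show ?thesis
    proof cases
      case 1
      then obtain c d q where q: "mset s = mset (c # d # q)" "cross c d \<noteq> 0" by (rule crossingD)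
      then have t: "mset t = mset (a # b # c # d # q)" using s by simp
      then have "zero_sum (a # b # c # d # q)" using split(2) zero_sum_cong_mset by blast
      moreover have "mset (a # b # c # d # q) \<subseteq># mset vs" using t vs by simp
      ultimately show ?thesis using s q unfolding two_crossing_pairs_def by blast
    next
      case 2
      then obtain u where u: "u \<noteq> []" "mset u \<subseteq># mset r" "zero_sum u" using has_zero_sumD by blast
      have "zero_sum (a # b # s)" using s split(2) zero_sum_cong_mset by blast
      moreover have "mset (a # b # s @ u) \<subseteq># mset vs"
        using s u vs by simp
      ultimately show ?thesis using s u unfolding crossing_pair_and_disjoint_def by blast
    qed
  next
    case line
    then have "l \<noteq> (0, 0)" by auto
    moreover have "5 \<le> size {#v \<in># mset vs. cross l v = 0#}"
      using line(2) by (metis mset_filter size_mset)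
    ultimately show ?thesis unfolding crowded_line_def by blast
  qed
qed

text \<open>With the two basis vectors fixed, at most 1287 multisets of five further vectors remain.
  All three configurations pass to larger multisets, as the search requires.\<close>

lemma seven_vectors:
  assumes M: "M = {#(1, 0), (0, 1)#} + N" and N: "5 \<le> size N"
  shows "two_crossing_pairs M \<or> crossing_pair_and_disjoint M \<or> crowded_line M"
proof -
  have mono: "two_crossing_pairs B \<or> crossing_pair_and_disjoint B \<or> crowded_line B"
    if "two_crossing_pairs A \<or> crossing_pair_and_disjoint A \<or> crowded_line A" and sub: "A \<subseteq># B" for A B
  proof -
    have "crowded_line A \<Longrightarrow> crowded_line B"
      unfolding crowded_line_def by (meson sub multiset_filter_mono size_mset_mono order_trans)
    moreover have "two_crossing_pairs A \<Longrightarrow> two_crossing_pairs B"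
      unfolding two_crossing_pairs_def by (meson sub subset_mset.order_trans)
    moreover have "crossing_pair_and_disjoint A \<Longrightarrow> crossing_pair_and_disjoint B"
      unfolding crossing_pair_and_disjoint_def by (meson sub subset_mset.order_trans)
    ultimately show ?thesis using that by blast
  qed
  have "search unavoidable (Suc (Suc (Suc (Suc (Suc 0))))) [(1, 0), (0, 1)] all_vecs"
    by code_simp
  then have "two_crossing_pairs (mset [(1, 0), (0, 1)] + N) \<or>
      crossing_pair_and_disjoint (mset [(1, 0), (0, 1)] + N) \<or> crowded_line (mset [(1, 0), (0, 1)] + N)"
    by (rule search_sound) (use N in \<open>simp_all add: set_all_vecs unavoidableD mono\<close>)
  then show ?thesis by (simp add: M)
qed

section \<open>Product-one subsequences\<close>

definition contains_product_one :: "('a, 'b) monoid_scheme \<Rightarrow> 'a multiset \<Rightarrow> bool" where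
  "contains_product_one G S \<longleftrightarrow> (\<exists>T. T \<subseteq># S \<and> product_one G T)"

lemma contains_product_one_mono:
  "contains_product_one G S \<Longrightarrow> S \<subseteq># T \<Longrightarrow> contains_product_one G T"
  unfolding contains_product_one_def by (meson subset_mset.order_trans)

text \<open>Coordinates are abstracted because different non-commuting pairs are used: two terms of
  the sequence, or a direction of a crowded line and a partner.\<close>

locale heisenberg_coords = group G for G (structure) +
  fixes w :: "triple \<Rightarrow> 'a"
  assumes bij: "bij_betw w UNIV (carrier G)"
    and w_mult: "w (heis_mult s t) = w s \<otimes> w t"
begin

lemma w_closed [simp]: "w t \<in> carrier G"
  using bij by (auto simp: bij_betw_def)

lemma w_eq_iff [simp]: "w s = w t \<longleftrightarrow> s = t"
  using bij by (auto simp: bij_betw_def dest: injD)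

lemma w_zero: "w (0, 0, 0) = \<one>"
  using w_mult[of "(0, 0, 0)" "(0, 0, 0)"] by simp

lemma w_commute_iff: "w s \<otimes> w t = w t \<otimes> w s \<longleftrightarrow> cross (proj s) (proj t) = 0"
  by (cases s; cases t) (simp add: w_mult[symmetric] algebra_simps)

lemma foldr_w: "foldr (\<otimes>) (map w ts) \<one> = w (heis_prod ts)"
  by (induction ts) (simp_all add: w_zero w_mult)

lemma obtain_coords:
  assumes "set_mset S \<subseteq> carrier G"
  obtains M where "S = image_mset w M"
proof
  have "image_mset w (image_mset (inv_into UNIV w) S) = image_mset (\<lambda>s. s) S"
    unfolding multiset.map_comp o_def
    by (rule image_mset_cong) (use assms bij in \<open>auto simp: bij_betw_def f_inv_into_f\<close>)
  then show "S = image_mset w (image_mset (inv_into UNIV w) S)" by simp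
qed

lemma contains_product_one_image: "contains_product_one G (image_mset w M) \<longleftrightarrow> contains_one M"
proof
  assume "contains_one M"
  then obtain ts where ts: "ts \<noteq> []" "mset ts \<subseteq># M" "heis_prod ts = (0, 0, 0)"
    unfolding contains_one_def by blast
  then have "mset (map w ts) \<subseteq># image_mset w M" by (simp add: image_mset_subseteq_mono)
  moreover have "product_one G (mset (map w ts))"
    unfolding product_one_def using ts foldr_w[of ts] w_zero
    by (metis (no_types, lifting) map_is_Nil_conv mset_zero_iff)
  ultimately show "contains_product_one G (image_mset w M)" unfolding contains_product_one_def by blast
next
  assume "contains_product_one G (image_mset w M)"
  then obtain xs where xs: "xs \<noteq> []" "mset xs \<subseteq># image_mset w M" "foldr (\<otimes>) xs \<one> = \<one>"
    unfolding contains_product_one_def product_one_def by auto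
  then obtain ts where "map w ts = xs" "mset ts \<subseteq># M" using mset_subset_map_lift by blast
  then show "contains_one M"
    using xs foldr_w[of ts] unfolding contains_one_def w_zero[symmetric] by auto
qed

end

section \<open>Sequences of length seven\<close>

text \<open>With x as first generator, commuting with x means that the middle coordinate is 0. There
  \<open>heis_mult\<close> is addition of the outer two coordinates, so five terms contain a zero
  sum.\<close>

lemma (in group) five_commuting:
  assumes card: "card (carrier G) = 27" and exp3: "\<forall>g\<in>carrier G. g [^] (3::nat) = \<one>"
    and x: "x \<in> carrier G" and y: "y \<in> carrier G" and nc: "x \<otimes> y \<noteq> y \<otimes> x"
    and S: "set_mset S \<subseteq> carrier G" "5 \<le> size S" and comm: "\<forall>s\<in>#S. x \<otimes> s = s \<otimes> x"
  shows "contains_product_one G S"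
proof -
  obtain w where "bij_betw w UNIV (carrier G)" "\<And>s t. w (heis_mult s t) = w s \<otimes> w t"
    and wx: "w (1, 0, 0) = x"
    using heisenberg_coordinates[OF card exp3 x y nc] by metis
  then interpret heisenberg_coords G w by unfold_locales
  obtain M where M: "S = image_mset w M" using obtain_coords S by blast
  have j0: "fst (snd t) = 0" if "t \<in># M" for t
  proof -
    have "cross (1, 0) (proj t) = 0"
      using comm that w_commute_iff[of "(1, 0, 0)" t] by (simp add: M wx)
    then show ?thesis by (cases t) simp
  qed
  \<comment> \<open>Unlike \<open>proj\<close>, this keeps the central coordinate and drops the
    middle one.\<close>
  define f :: "triple \<Rightarrow> vec" where "f t = (fst t, snd (snd t))" for t
  have "5 \<le> size (image_mset f M)" using S M by simp
  then obtain vs where vs: "vs \<noteq> []" "mset vs \<subseteq># image_mset f M" "zero_sum vs"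
    by (rule davenport_F3_squared)
  then obtain ts where ts: "map f ts = vs" "mset ts \<subseteq># M" using mset_subset_map_lift by blast
  have "heis_prod us = (sum_list (map fst (map f us)), 0, sum_list (map snd (map f us)))"
    if "mset us \<subseteq># M" for us
    using that
  proof (induction us)
    case (Cons u us)
    have "u \<in># M" "mset us \<subseteq># M"
      using Cons.prems by (auto dest: mset_subset_eqD mset_subset_eq_insertD)
    then show ?case using Cons.IH j0[of u] by (cases u) (simp add: f_def)
  qed simp
  from this[OF ts(2)] have "heis_prod ts = (0, 0, 0)"
    using vs(3) unfolding ts(1) zero_sum_def by simp
  then have "contains_one M" using ts vs unfolding contains_one_def by auto
  then show ?thesis by (simp add: M contains_product_one_image)
qed

lemma (in group) seven_contains_product_one:
  assumes card: "card (carrier G) = 27" and exp3: "\<forall>g\<in>carrier G. g [^] (3::nat) = \<one>"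
    and nonabelian: "\<exists>x\<in>carrier G. \<exists>y\<in>carrier G. x \<otimes> y \<noteq> y \<otimes> x"
    and S: "set_mset S \<subseteq> carrier G" "size S = 7"
  shows "contains_product_one G S"
proof (cases "\<exists>x\<in>#S. \<exists>y\<in>#S. x \<otimes> y \<noteq> y \<otimes> x")
  case False
  \<comment> \<open>All terms commute with each other. Either some term x is non-central and has a
    partner y in G, or all terms are central and any non-commuting pair will do.\<close>
  obtain x y where "x \<in> carrier G" "y \<in> carrier G" "x \<otimes> y \<noteq> y \<otimes> x" "\<forall>s\<in>#S. x \<otimes> s = s \<otimes> x"
  proof (cases "\<exists>x\<in>#S. \<exists>y\<in>carrier G. x \<otimes> y \<noteq> y \<otimes> x")
    case True
    then show thesis using that False S(1) by (metis subsetD)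
  next
    case central: False
    then show thesis using that nonabelian by metis
  qed
  then show ?thesis using five_commuting[OF card exp3] S by force
next
  case True
  then obtain x y where xy: "x \<in># S" "y \<in># S" "x \<otimes> y \<noteq> y \<otimes> x" by blast
  then have xyG: "x \<in> carrier G" "y \<in> carrier G" using S by auto
  obtain w where "bij_betw w UNIV (carrier G)" "\<And>s t. w (heis_mult s t) = w s \<otimes> w t"
    and wx: "w (1, 0, 0) = x" and wy: "w (0, 1, 0) = y"
    using heisenberg_coordinates[OF card exp3 xyG xy(3)] by metis
  then interpret heisenberg_coords G w by unfold_locales
  obtain M where M: "S = image_mset w M" using obtain_coords S by blast
  have "(1, 0, 0) \<in># M" "(0, 1, 0) \<in># M"
    using xy(1,2) unfolding M wx[symmetric] wy[symmetric] by auto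
  then obtain N' where N': "M = add_mset (1, 0, 0) N'" "(0, 1, 0) \<in># N'"
    by (metis insert_noteq_member multi_member_split prod.inject zero_neq_one)
  then obtain N where N: "M = {#(1, 0, 0), (0, 1, 0)#} + N"
    using multi_member_split[of _ N'] by fastforce
  have "size (image_mset proj N) = 5" using S M N by simp
  moreover have PM: "image_mset proj M = {#(1, 0), (0, 1)#} + image_mset proj N" by (simp add: N)
  ultimately consider "two_crossing_pairs (image_mset proj M)"
    | "crossing_pair_and_disjoint (image_mset proj M)" | "crowded_line (image_mset proj M)"
    using seven_vectors by fastforce
  then show ?thesis
  proof cases
    case 1
    then obtain a b c d r where r: "mset (a # b # c # d # r) \<subseteq># image_mset proj M"
      "zero_sum (a # b # c # d # r)" "cross a b \<noteq> 0" "cross c d \<noteq> 0"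
      unfolding two_crossing_pairs_def by blast
    obtain us where "map proj us = a # b # c # d # r" "mset us \<subseteq># M"
      using mset_subset_map_lift[OF r(1)] by blast
    then have "contains_one M"
      using r(2-4) by (auto simp: map_eq_Cons_conv intro!: contains_one_two_pairs)
    then show ?thesis by (simp add: M contains_product_one_image)
  next
    case 2
    then obtain a b r s where r: "mset (a # b # r @ s) \<subseteq># image_mset proj M"
      "zero_sum (a # b # r)" "cross a b \<noteq> 0" "s \<noteq> []" "zero_sum s"
      unfolding crossing_pair_and_disjoint_def by blast
    obtain us where "map proj us = a # b # r @ s" "mset us \<subseteq># M"
      using mset_subset_map_lift[OF r(1)] by blast
    then obtain a' b' r' s' where "us = a' # b' # r' @ s'" "a = proj a'" "b = proj b'"
      "r = map proj r'" "s = map proj s'"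
      by (auto simp: map_eq_Cons_conv map_eq_append_conv)
    then have "contains_one M"
      using r(2-5) \<open>mset us \<subseteq># M\<close> by (intro contains_one_pair_and_disjoint[of a' b' r' s']) auto
    then show ?thesis by (simp add: M contains_product_one_image)
  next
    case 3
    then obtain l where l: "l \<noteq> (0, 0)" "5 \<le> size {#v \<in># image_mset proj M. cross l v = 0#}"
      unfolding crowded_line_def by blast
    obtain i j where ij: "l = (i, j)" by (cases l)
    \<comment> \<open>A lift of the direction l, not necessarily a term of S. Together with a
      non-commuting h it yields new coordinates in which the crowded terms commute with the first
      generator.\<close>
    define g where "g = w (i, j, 0)"
    define K where "K = {#t \<in># M. cross l (proj t) = 0#}"
    have "\<exists>h\<in>carrier G. g \<otimes> h \<noteq> h \<otimes> g"
    proof (cases "j = 0")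
      case True
      then have "g \<otimes> w (0, 1, 0) \<noteq> w (0, 1, 0) \<otimes> g" 
        unfolding g_def w_commute_iff using l ij by simp
      then show ?thesis by auto
    next
      case False
      then have "g \<otimes> w (1, 0, 0) \<noteq> w (1, 0, 0) \<otimes> g" 
        unfolding g_def w_commute_iff by simp
      then show ?thesis by auto
    qed
    then obtain h where h: "h \<in> carrier G" "g \<otimes> h \<noteq> h \<otimes> g" by blast
    have g: "g \<in> carrier G" by (simp add: g_def)
    have "contains_product_one G (image_mset w K)"
    proof (rule five_commuting[OF card exp3 g h])
      show "5 \<le> size (image_mset w K)"
        using l(2) by (simp add: K_def filter_mset_image_mset)
      show "\<forall>s\<in>#image_mset w K. g \<otimes> s = s \<otimes> g"
        unfolding g_def by (auto simp: K_def w_commute_iff ij)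
    qed auto
    moreover have "image_mset w K \<subseteq># S"
      unfolding K_def M by (intro image_mset_subseteq_mono multiset_filter_subset)
    ultimately show ?thesis by (rule contains_product_one_mono)
  qed
qed

section \<open>A product-one free sequence of length six\<close>

text \<open>The sequence is x, x, y, y, z, z. A zero sum in the plane forces the numbers of x and of
  y used to be multiples of 3, hence 0; one or two copies of z do not multiply to 1.\<close>

lemma not_contains_one_six:
  "\<not> contains_one {#(1, 0, 0), (1, 0, 0), (0, 1, 0), (0, 1, 0), (0, 0, 1), (0, 0, 1)#}"
proof
  let ?M = "{#(1, 0, 0), (1, 0, 0), (0, 1, 0), (0, 1, 0), (0, 0, 1), (0, 0, 1)#} :: triple multiset"
  assume "contains_one ?M"
  then obtain ts where ts: "ts \<noteq> []" "mset ts \<subseteq># ?M" "heis_prod ts = (0, 0, 0)"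
    unfolding contains_one_def by blast
  define a b c where "a = count (mset ts) (1, 0, 0)" and "b = count (mset ts) (0, 1, 0)"
    and "c = count (mset ts) (0, 0, 1)"
  have le: "count (mset ts) t \<le> count ?M t" for t using ts(2) by (rule mset_subset_eq_count)
  have abc: "a \<le> 2" "b \<le> 2" "c \<le> 2"
    using le[of "(1, 0, 0)"] le[of "(0, 1, 0)"] le[of "(0, 0, 1)"] by (simp_all add: a_def b_def c_def)
  have eq: "mset ts = replicate_mset a (1, 0, 0) + replicate_mset b (0, 1, 0) + replicate_mset c (0, 0, 1)"
  proof (rule multiset_eqI)
    fix t
    show "count (mset ts) t = count (replicate_mset a (1, 0, 0) + replicate_mset b (0, 1, 0) + replicate_mset c (0, 0, 1)) t"
      using le[of t] by (auto simp: a_def b_def c_def)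
  qed
  have no_two: "of_nat n \<noteq> (0 :: F3)" if "n \<le> 2" "n \<noteq> 0" for n
  proof -
    have "n = 1 \<or> n = 2" using that by auto
    then show ?thesis by (auto simp: F3_arith)
  qed
  have "fst \<circ> proj = fst" "snd \<circ> proj = fst \<circ> snd" by auto
  moreover have "zero_sum (map proj ts)" using ts(3) zero_sum_heis_prod by blast
  ultimately have "sum_mset (image_mset fst (mset ts)) = 0"
    "sum_mset (image_mset (fst \<circ> snd) (mset ts)) = 0"
    by (simp_all add: zero_sum_def flip: sum_mset_sum_list)
  then have "of_nat a = (0 :: F3)" "of_nat b = (0 :: F3)" unfolding eq by simp_all
  then have "a = 0" "b = 0" using no_two abc by blast+
  then have z: "mset ts = replicate_mset c (0, 0, 1)" using eq by simp
  have "length ts = c" using arg_cong[OF z, of size] by simp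
  moreover have "t = (0, 0, 1)" if "t \<in> set ts" for t
    using arg_cong[OF z, of set_mset] that by (simp split: if_splits)
  ultimately have "ts = replicate c (0, 0, 1)" by (rule replicate_eqI)
  moreover have "heis_prod (replicate n (0, 0, 1)) = (0, 0, of_nat n)" for n
    by (induction n) simp_all
  ultimately show False using ts no_two abc by auto
qed

theorem theorem3p1:
  fixes G :: "('a, 'b) monoid_scheme"
  assumes "group G"
    and "finite (carrier G)"
    and "card (carrier G) = 27"
    and "\<forall>x\<in>carrier G. x [^]\<^bsub>G\<^esub> (3::nat) = \<one>\<^bsub>G\<^esub>"
    and "\<exists>x\<in>carrier G. \<exists>y\<in>carrier G. x \<otimes>\<^bsub>G\<^esub> y \<noteq> y \<otimes>\<^bsub>G\<^esub> x"
  shows "(\<forall>S. seq_over G S \<and> size S = 7 \<longrightarrow> (\<exists>T. T \<subseteq># S \<and> product_one G T))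
         \<and> small_davenport G = 6"
proof -
  interpret group G by fact
  have seven: "contains_product_one G S" if "seq_over G S" "size S = 7" for S
    using that assms seven_contains_product_one unfolding seq_over_def by blast
  obtain x y where xy: "x \<in> carrier G" "y \<in> carrier G" "x \<otimes>\<^bsub>G\<^esub> y \<noteq> y \<otimes>\<^bsub>G\<^esub> x"
    using assms(5) by blast
  obtain w where "bij_betw w UNIV (carrier G)" "\<And>s t. w (heis_mult s t) = w s \<otimes>\<^bsub>G\<^esub> w t"
    using heisenberg_coordinates[OF assms(3,4) xy] by metis
  then interpret heisenberg_coords G w by unfold_locales
  let ?M = "{#(1, 0, 0), (1, 0, 0), (0, 1, 0), (0, 1, 0), (0, 0, 1), (0, 0, 1)#}"
  have "small_davenport G = 6"
    unfolding small_davenport_def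
  proof (rule Greatest_equality)
    have "seq_over G (image_mset w ?M)" by (simp add: seq_over_def)
    moreover have "product_one_free G (image_mset w ?M)"
      using contains_product_one_image not_contains_one_six
      unfolding product_one_free_def contains_product_one_def by blast
    moreover have "size (image_mset w ?M) = 6" by simp
    ultimately show "\<exists>S. seq_over G S \<and> product_one_free G S \<and> size S = 6" by blast
  next
    fix n assume "\<exists>S. seq_over G S \<and> product_one_free G S \<and> size S = n"
    then obtain S where S: "seq_over G S" "product_one_free G S" "size S = n" by blast
    show "n \<le> 6"
    proof (rule ccontr)
      assume "\<not> n \<le> 6"
      obtain xs where xs: "mset xs = S" by (metis ex_mset)
      with \<open>\<not> n \<le> 6\<close> have len: "7 \<le> length xs" using S(3) by (auto simp flip: size_mset)
      \<comment> \<open>A longer sequence is cut to seven terms, so the case of length 7 bounds all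
        lengths.\<close>
      have "mset (take 7 xs) \<subseteq># S" using xs by (metis append_take_drop_id mset_append mset_subset_eq_add_left)
      moreover have "seq_over G (mset (take 7 xs))"
        using S(1) \<open>mset (take 7 xs) \<subseteq># S\<close> unfolding seq_over_def by (meson order_trans set_mset_mono)
      then have "contains_product_one G (mset (take 7 xs))" using seven len by simp
      ultimately have "contains_product_one G S" by (metis contains_product_one_mono)
      then show False using S(2) unfolding contains_product_one_def product_one_free_def by blast
    qed
  qed
  then show ?thesis using seven unfolding contains_product_one_def by blast
qed

end
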